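(* Let $P$ be a Puiseux monoid that does not contain $0$ as a limit point. If $P$ is bounded, then $\rho_k(P) < \infty$ for every $k \in \mathbb{N}$.
   Context: $\mathbb{N}$ denotes the set of positive integers and $\mathbb{N}_0 = \mathbb{N}\cup\{0\}$. A Puiseux monoid is an additive submonoid of $(\mathbb{Q},+)$ consisting of nonnegative rationals. A Puiseux monoid is bounded if it can be generated (as a monoid) by a bounded set of rational numbers. That $0$ is a limit point of $P$ means that $P$ contains nonzero elements arbitrarily close to $0$. An element $a \in P\setminus\{0\}$ is an atom if $a = x+y$ with $x,y\in P$ implies $x=0$ or $y=0$; $\mathcal{A}(P)$ denotes the set of atoms of $P$. A factorization of $x \in P$ is a formal sum (up to permutation) $a_1+\dots+a_\ell$ of atoms of $P$ (repetitions allowed) whose value in $P$ is $x$; its length is $\ell$. $\mathsf{L}(x)$ is the set of all lengths of factorizations of $x$. For $n\in\mathbb{N}_0$, $\mathcal{U}_n(P)$ is the union of the sets $\mathsf{L}(x)$ over all $x \in P$ with $n \in \mathsf{L}(x)$, and $\rho_n(P) = \sup \mathcal{U}_n(P)$ (supremum taken in $\mathbb{N}_0\cup\{\infty\}$) is the $n$-th local elasticity of $P$. *)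

theory Defs
  imports "HOL-Analysis.Analysis" "HOL-Library.Multiset" "HOL-Library.Extended_Nat"
begin

definition rat_submonoid :: "rat set \<Rightarrow> bool" where
  "rat_submonoid P \<longleftrightarrow> 0 \<in> P \<and> (\<forall>x\<in>P. \<forall>y\<in>P. x + y \<in> P)"

definition puiseux_monoid :: "rat set \<Rightarrow> bool" where
  "puiseux_monoid P \<longleftrightarrow> rat_submonoid P \<and> (\<forall>x\<in>P. 0 \<le> x)"

(* "rat_submonoid hull S" is the submonoid of (Q,+) generated by S. *)
definition bounded_puiseux :: "rat set \<Rightarrow> bool" where
  "bounded_puiseux P \<longleftrightarrow>
     (\<exists>S. bdd_below S \<and> bdd_above S \<and> rat_submonoid hull S = P)"

definition atoms :: "rat set \<Rightarrow> rat set" where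
  "atoms P = {a \<in> P - {0}. \<forall>x\<in>P. \<forall>y\<in>P. a = x + y \<longrightarrow> x = 0 \<or> y = 0}"

(* Formal sums of atoms up to permutation are finite multisets of atoms;
   the empty multiset is the factorization of 0. *)
definition factorizations :: "rat set \<Rightarrow> rat \<Rightarrow> rat multiset set" where
  "factorizations P x = {z. set_mset z \<subseteq> atoms P \<and> sum_mset z = x}"

definition lengths :: "rat set \<Rightarrow> rat \<Rightarrow> nat set" where
  "lengths P x = size ` factorizations P x"

definition length_union :: "rat set \<Rightarrow> nat \<Rightarrow> nat set" where
  "length_union P n = (\<Union>x\<in>{x \<in> P. n \<in> lengths P x}. lengths P x)"

(* The supremum is taken in enat, so that it is 0 on the empty set. *)
definition local_elasticity :: "rat set \<Rightarrow> nat \<Rightarrow> enat" where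
  "local_elasticity P n = Sup (enat ` length_union P n)"

end

theory Submission
  imports Defs
begin

text \<open>
  The atoms of \<^term>\<open>P\<close> lie in a fixed interval \<open>[e, M]\<close> with \<open>0 < e\<close>. The upper bound comes from
  boundedness, because an atom cannot be obtained from other elements and therefore belongs to every
  generating set (\<open>atoms_subset_generators\<close>); the lower bound holds because \<open>0\<close> is not a limit point
  (\<open>nonzero_elements_bounded_below\<close>). An element with a factorization of length \<open>k\<close> is then at most
  \<open>k * M\<close>, while one with a factorization of length \<open>l\<close> is at least \<open>l * e\<close>. Hence every length in
  \<^term>\<open>length_union P k\<close> satisfies \<open>l \<le> k * M / e\<close>.
\<close>

text \<open>
  The defining property of an atom \<open>a\<close> says exactly that removing \<open>a\<close> from the monoid leaves a set
  closed under addition. A generating set that missed \<open>a\<close> would generate only a part of that smaller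
  submonoid.
\<close>

lemma atoms_subset_generators:
  assumes P: "rat_submonoid P" and gen: "rat_submonoid hull S = P"
  shows "atoms P \<subseteq> S"
proof
  fix a assume a: "a \<in> atoms P"
  have "rat_submonoid (P - {a})"
    using P a by (fastforce simp: rat_submonoid_def atoms_def)
  moreover have "S \<subseteq> P"
    using hull_subset[of S rat_submonoid] gen by simp
  ultimately have "P \<subseteq> P - {a}" if "a \<notin> S"
    using hull_minimal[of S "P - {a}" rat_submonoid] gen that by blast
  then show "a \<in> S"
    using a by (auto simp: atoms_def)
qed

lemma nonzero_elements_bounded_below:
  fixes P :: "rat set"
  assumes nonneg: "\<forall>x\<in>P. 0 \<le> x" and "\<not> (0::real) islimpt (real_of_rat ` P)"
  obtains e :: rat where "e > 0" and "\<And>x. x \<in> P \<Longrightarrow> x \<noteq> 0 \<Longrightarrow> e \<le> x"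
proof -
  obtain d :: real where d: "d > 0"
    and far: "\<And>y. y \<in> real_of_rat ` P \<Longrightarrow> y \<noteq> 0 \<Longrightarrow> d \<le> dist y 0"
    using assms(2) unfolding islimpt_approachable by (metis not_le)
  obtain e :: rat where e: "0 < real_of_rat e" "real_of_rat e < d"
    using of_rat_dense[OF d] by auto
  show ?thesis
  proof
    show "e > 0" using e by simp
    fix x assume x: "x \<in> P" "x \<noteq> 0"
    then have "d \<le> real_of_rat x"
      using far[of "real_of_rat x"] nonneg by simp
    then have "real_of_rat e \<le> real_of_rat x" using e by simp
    then show "e \<le> x" by (simp add: of_rat_less_eq)
  qed
qed

lemma sum_mset_le_size_times:
  fixes M :: "'a::linordered_semidom"
  assumes "\<And>a. a \<in># z \<Longrightarrow> a \<le> M"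
  shows "sum_mset z \<le> of_nat (size z) * M"
  using assms by (induction z) (auto simp: distrib_right intro!: add_mono)

lemma size_times_le_sum_mset:
  fixes e :: "'a::linordered_semidom"
  assumes "\<And>a. a \<in># z \<Longrightarrow> e \<le> a"
  shows "of_nat (size z) * e \<le> sum_mset z"
  using assms by (induction z) (auto simp: distrib_right intro!: add_mono)

lemma length_union_bounded:
  assumes "e > 0" and bounds: "\<And>a. a \<in> atoms P \<Longrightarrow> e \<le> a \<and> a \<le> M"
    and "l \<in> length_union P k"
  shows "of_nat l \<le> of_nat k * M / e"
proof -
  obtain z w where z: "set_mset z \<subseteq> atoms P" "size z = k"
    and w: "set_mset w \<subseteq> atoms P" "size w = l" and eq: "sum_mset z = sum_mset w"
    using assms(3) by (auto simp: length_union_def lengths_def factorizations_def)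
  have "of_nat l * e \<le> sum_mset w"
    using size_times_le_sum_mset[of w e] w bounds by blast
  also have "\<dots> \<le> of_nat k * M"
    using sum_mset_le_size_times[of z M] z bounds unfolding eq by blast
  finally show ?thesis
    using \<open>e > 0\<close> by (simp add: pos_le_divide_eq)
qed

theorem proposition3p3:
  fixes P :: "rat set" and k :: nat
  assumes "puiseux_monoid P"
    and "\<not> (0::real) islimpt (real_of_rat ` P)"
    and "bounded_puiseux P"
    and "k \<ge> 1"
  shows "local_elasticity P k < \<infinity>"
proof -
  have P: "rat_submonoid P" and nonneg: "\<forall>x\<in>P. 0 \<le> x"
    using assms(1) by (auto simp: puiseux_monoid_def)
  obtain S where "bdd_above S" and "rat_submonoid hull S = P"
    using assms(3) by (auto simp: bounded_puiseux_def)
  then obtain M where M: "\<And>a. a \<in> atoms P \<Longrightarrow> a \<le> M"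
    using atoms_subset_generators[OF P] unfolding bdd_above_def by blast
  obtain e where e: "e > 0" "\<And>x. x \<in> P \<Longrightarrow> x \<noteq> 0 \<Longrightarrow> e \<le> x"
    using nonzero_elements_bounded_below[OF nonneg assms(2)] by blast
  have "e \<le> a \<and> a \<le> M" if "a \<in> atoms P" for a
    using that e(2) M by (auto simp: atoms_def)
  then have bound: "of_nat l \<le> of_nat k * M / e" if "l \<in> length_union P k" for l
    using length_union_bounded[OF e(1)] that by blast
  obtain N :: nat where "of_nat k * M / e \<le> of_nat N"
    using real_arch_simple by blast
  then have "l \<le> N" if "l \<in> length_union P k" for l
    using bound[OF that] of_nat_le_iff[where 'a = rat] order_trans by blast
  then have "local_elasticity P k \<le> enat N"
    unfolding local_elasticity_def by (auto intro!: SUP_least)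
  then show ?thesis
    by (rule order_le_less_trans) simp
qed

end
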